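(* For every fixed graph $H$ with $\rho(H)<2$ there exist a function $p:\mathbb N\to(0,1)$ with $p(N)/p^*_H(N)\to0$ and a $k$-wise independent random graph $\{\mathcal G^k(N,p)\}_N$ with $k=\lceil 2/\rho(H)-1\rceil$, such that with probability tending to $1$ as $N\to\infty$, $\mathcal G^k(N,p)$ contains a copy of $H$ as an induced subgraph.
   Context: A $k$-wise independent random graph $\{\mathcal G^k(N,p)\}_N$ is a sequence, indexed by $N$, of probability distributions on simple undirected graphs with vertex set $\{1,\dots,N\}$ such that every potential edge appears with probability $p(N)$ and the indicator random variables of the appearance of any $k(N)$ potential edges are mutually independent. For a graph $H$, $v(H)$ and $e(H)$ are its numbers of vertices and edges; $\rho(H)$ is the minimum, over all subgraphs $H'$ of $H$ with at least one edge (including $H$ itself), of $v(H')/e(H')$; and $p^*_H(N)=N^{-\rho(H)}$. *)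

theory Defs
  imports "HOL-Probability.Probability"
begin

text \<open>An undirected graph is a pair of a vertex set and a set of edges, an edge being a
  two-element set of vertices.\<close>

type_synonym 'a ugraph = "'a set \<times> 'a set set"

abbreviation verts :: "'a ugraph \<Rightarrow> 'a set" where
  "verts G \<equiv> fst G"

abbreviation edges :: "'a ugraph \<Rightarrow> 'a set set" where
  "edges G \<equiv> snd G"

definition potential_edges :: "'a set \<Rightarrow> 'a set set" where
  "potential_edges V = {e. e \<subseteq> V \<and> card e = 2}"

definition simple_graph :: "'a ugraph \<Rightarrow> bool" where
  "simple_graph G \<longleftrightarrow> finite (verts G) \<and> edges G \<subseteq> potential_edges (verts G)"

definition subgraph :: "'a ugraph \<Rightarrow> 'a ugraph \<Rightarrow> bool" where
  "subgraph H' H \<longleftrightarrow> simple_graph H' \<and> verts H' \<subseteq> verts H \<and> edges H' \<subseteq> edges H"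

definition induced_subgraph :: "'a ugraph \<Rightarrow> 'a set \<Rightarrow> 'a ugraph" where
  "induced_subgraph G W = (W, {e \<in> edges G. e \<subseteq> W})"

definition isomorphic :: "'a ugraph \<Rightarrow> 'b ugraph \<Rightarrow> bool" where
  "isomorphic G H \<longleftrightarrow>
     (\<exists>f. bij_betw f (verts G) (verts H) \<and>
          (\<forall>u\<in>verts G. \<forall>v\<in>verts G. {u, v} \<in> edges G \<longleftrightarrow> {f u, f v} \<in> edges H))"

definition contains_induced_copy :: "'b ugraph \<Rightarrow> 'a ugraph \<Rightarrow> bool" where
  "contains_induced_copy G H \<longleftrightarrow>
     (\<exists>W\<subseteq>verts G. isomorphic H (induced_subgraph G W))"

text \<open>Meaningful only for finite graphs with at least one edge: otherwise the minimum is taken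
  over an empty or infinite set.\<close>

definition rho :: "'a ugraph \<Rightarrow> real" where
  "rho H = Min {real (card (verts H')) / real (card (edges H')) | H'.
                  subgraph H' H \<and> edges H' \<noteq> {}}"

definition p_star :: "'a ugraph \<Rightarrow> nat \<Rightarrow> real" where
  "p_star H N = real N powr (- rho H)"

text \<open>There are only finitely many graphs on the vertices from 1 to \<open>N\<close>, so every probability
  distribution on them is a pmf. Independence is required of any \<open>at most k N\<close> potential edges.
  Once there are \<open>k N\<close> potential edges this is the same as asking it of exactly \<open>k N\<close> of them;
  for smaller \<open>N\<close> it asks for full independence instead of being vacuous.\<close>

definition kwise_indep_random_graph ::
  "(nat \<Rightarrow> nat) \<Rightarrow> (nat \<Rightarrow> real) \<Rightarrow> (nat \<Rightarrow> nat ugraph pmf) \<Rightarrow> bool" where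
  "kwise_indep_random_graph k p \<G> \<longleftrightarrow>
     (\<forall>N. (\<forall>G\<in>set_pmf (\<G> N). simple_graph G \<and> verts G = {1..N}) \<and>
          (\<forall>e\<in>potential_edges {1..N}. measure_pmf.prob (\<G> N) {G. e \<in> edges G} = p N) \<and>
          (\<forall>S\<subseteq>potential_edges {1..N}. card S \<le> k N \<longrightarrow>
             prob_space.indep_vars (measure_pmf (\<G> N)) (\<lambda>_. borel)
               (\<lambda>e G. indicator (edges G) e :: real) S))"

end

theory Submission
  imports Defs
begin

text \<open>Since \<open>k < 2 / \<rho>\<close>, one can take \<open>p = N powr -c / 2\<close> with \<open>\<rho> < c < 2 / k\<close>, so that
  \<open>N\<^sup>2 p^k\<close> tends to infinity. Place about \<open>N\<^sup>2\<close> pairwise edge-disjoint copies of the vertex set of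
  \<open>H\<close> in \<open>{1..N}\<close>, and draw the edges inside the copies (and the leftover edges) independently for
  different copies. Inside one copy use a \<open>k\<close>-wise independent distribution that gives the edge set
  of \<open>H\<close> probability of order \<open>p^k\<close>. The result is \<open>k\<close>-wise independent, and the
  probability that no copy carries exactly \<open>H\<close> is at most \<open>(1 - const * p^k)^(const * N\<^sup>2)\<close>.\<close>

section \<open>Moments of random subsets, and a \<open>k\<close>-wise independent law with one heavy
  set\<close>

text \<open>Moebius inversion on the lattice of subsets: for \<open>T \<subseteq> S\<close>, passing
  to complements in \<open>S\<close> turns the sum into the expansion of \<open>1 - 1\<close> raised
  to the power \<open>card (S - T)\<close>.\<close>

lemma sum_sign_Icc:
  assumes "finite S"
  shows "(\<Sum>X | T \<subseteq> X \<and> X \<subseteq> S. (-1) ^ card (S - X)) = (if S = T then 1 else 0 :: real)"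
proof (cases "T \<subseteq> S")
  case True
  have "(\<Sum>X | T \<subseteq> X \<and> X \<subseteq> S. (-1) ^ card (S - X)) = (\<Sum>Y\<in>Pow (S - T). (-1) ^ card Y :: real)"
    by (rule sum.reindex_bij_witness[where i = "\<lambda>Y. S - Y" and j = "\<lambda>X. S - X"])
      (use True in \<open>auto simp: double_diff\<close>)
  also have "\<dots> = (\<Sum>Y\<in>Pow (S - T). (\<Prod>i\<in>Y. -1) * (\<Prod>i\<in>S - T - Y. 1))"
    by simp
  also have "\<dots> = (\<Prod>i\<in>S - T. -1 + 1)"
    by (rule prod_add[symmetric]) (use assms in auto)
  also have "\<dots> = (if S = T then 1 else 0)"
    using True assms by auto
  finally show ?thesis .
next
  case False
  then have "{X. T \<subseteq> X \<and> X \<subseteq> S} = {}" "S \<noteq> T" by auto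
  then show ?thesis by (simp only: sum.empty if_False)
qed

text \<open>Summation over supersets is inverted by alternating signs, so \<open>a\<close> is taken
  as the Moebius transform of the indicator of \<open>\<F>\<close>, the subsets of \<open>F\<close>
  with at most \<open>k\<close> elements. This truncation makes \<open>a\<close> vanish on larger
  sets, yet keeps the moments of order at most \<open>k\<close> equal to those of a point mass at
  \<open>F\<close>.\<close>

lemma low_degree_interpolation:
  assumes "finite B" "F \<subseteq> B"
  obtains a :: "'e set \<Rightarrow> real"
  where "\<And>X. \<bar>a X\<bar> \<le> 2 ^ card B" "\<And>X. card X > k \<Longrightarrow> a X = 0"
    "\<And>T. T \<subseteq> B \<Longrightarrow> card T \<le> k \<Longrightarrow> (\<Sum>X | T \<subseteq> X \<and> X \<subseteq> B. a X) = (if T \<subseteq> F then 1 else 0)"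
proof
  define \<F> where "\<F> = {S. S \<subseteq> F \<and> card S \<le> k}"
  have finF: "finite F" using assms finite_subset by blast
  have fin: "finite \<F>" unfolding \<F>_def using finF by auto
  define a where "a = (\<lambda>X. \<Sum>S | S \<in> \<F> \<and> X \<subseteq> S. (-1) ^ card (S - X) :: real)"
  show "\<bar>a X\<bar> \<le> 2 ^ card B" for X
  proof -
    have "\<bar>a X\<bar> \<le> (\<Sum>S | S \<in> \<F> \<and> X \<subseteq> S. \<bar>(-1) ^ card (S - X)\<bar>)"
      unfolding a_def by (rule sum_abs)
    also have "\<dots> = real (card {S \<in> \<F>. X \<subseteq> S})"
      by (simp add: power_abs)
    also have "\<dots> \<le> real (card (Pow B))"
      using assms by (intro of_nat_mono card_mono) (auto simp: \<F>_def)
    finally show ?thesis using assms by (simp add: card_Pow)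
  qed
  show "a X = 0" if "card X > k" for X
  proof -
    have "{S \<in> \<F>. X \<subseteq> S} = {}"
      using that finF by (auto simp: \<F>_def) (meson card_mono finite_subset le_trans not_le)
    then show ?thesis unfolding a_def by (simp only: sum.empty)
  qed
  show "(\<Sum>X | T \<subseteq> X \<and> X \<subseteq> B. a X) = (if T \<subseteq> F then 1 else 0)"
    if T: "T \<subseteq> B" "card T \<le> k" for T
  proof -
    have finT: "finite {X. T \<subseteq> X \<and> X \<subseteq> B}" using assms by auto
    have "(\<Sum>X | T \<subseteq> X \<and> X \<subseteq> B. a X) =
        (\<Sum>S\<in>\<F>. \<Sum>X | X \<in> {X. T \<subseteq> X \<and> X \<subseteq> B} \<and> X \<subseteq> S. (-1) ^ card (S - X))"
      unfolding a_def by (rule sum.swap_restrict[OF finT fin])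
    \<comment> \<open>After the exchange of sums, the inner sum runs over the interval from
      \<open>T\<close> to \<open>S\<close>, so only \<open>S = T\<close> survives.\<close>
    also have "\<dots> = (\<Sum>S\<in>\<F>. if S = T then 1 else 0)"
    proof (rule sum.cong[OF refl])
      fix S assume "S \<in> \<F>"
      then have S: "S \<subseteq> B" "finite S" using assms finite_subset[OF _ finF] by (auto simp: \<F>_def)
      then have "{X. X \<in> {X. T \<subseteq> X \<and> X \<subseteq> B} \<and> X \<subseteq> S} = {X. T \<subseteq> X \<and> X \<subseteq> S}" by auto
      then show "(\<Sum>X | X \<in> {X. T \<subseteq> X \<and> X \<subseteq> B} \<and> X \<subseteq> S. (-1) ^ card (S - X)) = (if S = T then 1 else 0 :: real)"
        using sum_sign_Icc[OF S(2)] by simp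
    qed
    also have "\<dots> = (if T \<subseteq> F then 1 else 0)"
      using T fin by (simp add: \<F>_def)
    finally show ?thesis .
  qed
qed

lemma sum_bernoulli_weights:
  fixes p :: real
  assumes "finite B" "T \<subseteq> B"
  shows "(\<Sum>X | T \<subseteq> X \<and> X \<subseteq> B. p ^ card X * (1 - p) ^ card (B - X)) = p ^ card T"
proof -
  \<comment> \<open>Giving omission the weight 0 on \<open>T\<close> removes from the expanded
    product exactly the sets that miss a point of \<open>T\<close>; outside \<open>T\<close> each
    factor is \<open>p + (1 - p) = 1\<close>.\<close>
  define g where "g = (\<lambda>i. if i \<in> T then 0 else 1 - p)"
  have "p ^ card T = (\<Prod>i\<in>T. p + g i) * (\<Prod>i\<in>B - T. p + g i)"
    by (simp add: g_def)
  also have "\<dots> = (\<Prod>i\<in>B. p + g i)"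
    using assms by (metis mult.commute prod.subset_diff)
  also have "\<dots> = (\<Sum>X\<in>Pow B. (\<Prod>i\<in>X. p) * (\<Prod>i\<in>B - X. g i))"
    by (rule prod_add[OF assms(1)])
  also have "\<dots> = (\<Sum>X | T \<subseteq> X \<and> X \<subseteq> B. (\<Prod>i\<in>X. p) * (\<Prod>i\<in>B - X. g i))"
    using assms by (intro sum.mono_neutral_right) (auto simp: g_def intro!: prod_zero)
  also have "\<dots> = (\<Sum>X | T \<subseteq> X \<and> X \<subseteq> B. p ^ card X * (1 - p) ^ card (B - X))"
  proof (rule sum.cong[OF refl])
    fix X assume "X \<in> {X. T \<subseteq> X \<and> X \<subseteq> B}"
    then have "(\<Prod>i\<in>B - X. g i) = (\<Prod>i\<in>B - X. 1 - p)"
      by (intro prod.cong) (auto simp: g_def)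
    then show "(\<Prod>i\<in>X. p) * (\<Prod>i\<in>B - X. g i) = p ^ card X * (1 - p) ^ card (B - X)" by simp
  qed
  finally show ?thesis by simp
qed

lemma ex_pmf_weights:
  fixes w :: "'e \<Rightarrow> real"
  assumes "finite A" "\<And>x. x \<in> A \<Longrightarrow> w x \<ge> 0" "sum w A = 1"
  obtains D where "set_pmf D \<subseteq> A" "\<And>x. x \<in> A \<Longrightarrow> pmf D x = w x"
proof
  define f where "f = (\<lambda>x. if x \<in> A then w x else 0)"
  have nn: "f x \<ge> 0" for x using assms by (simp add: f_def)
  have "(\<integral>\<^sup>+x. ennreal (f x) \<partial>count_space UNIV) = (\<Sum>x\<in>A. ennreal (f x))"
    using assms by (intro nn_integral_count_space') (auto simp: f_def)
  also have "\<dots> = ennreal (sum w A)"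
    using assms by (subst sum_ennreal) (auto simp: f_def)
  finally have one: "(\<integral>\<^sup>+x. ennreal (f x) \<partial>count_space UNIV) = 1" using assms by simp
  show "set_pmf (embed_pmf f) \<subseteq> A"
    using set_embed_pmf[OF nn one] by (auto simp: f_def split: if_splits)
  show "pmf (embed_pmf f) x = w x" if "x \<in> A" for x
    using pmf_embed_pmf[OF nn one] that by (simp add: f_def)
qed

text \<open>Add to the product measure a small multiple of the signed measure that has mass 1 at \<open>F\<close>
  and is otherwise supported on sets of size at most \<open>k\<close>, chosen so that all its moments of order
  at most \<open>k\<close> vanish. Every set of size at most \<open>k\<close> has product measure at least
  \<open>p ^ k / 2 ^ card B\<close>, so the multiple can be as large as \<open>p ^ k / 4 ^ card B\<close>.\<close>

lemma kwise_pmf_heavy_at: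
  fixes p :: real
  assumes "finite B" "F \<subseteq> B" "0 < p" "p \<le> 1/2"
  obtains D where "set_pmf D \<subseteq> Pow B"
    "\<And>T. T \<subseteq> B \<Longrightarrow> card T \<le> k \<Longrightarrow> measure_pmf.prob D {X. T \<subseteq> X} = p ^ card T"
    "pmf D F \<ge> p ^ k / 4 ^ card B"
proof -
  obtain a :: "'a set \<Rightarrow> real" where a: "\<And>X. \<bar>a X\<bar> \<le> 2 ^ card B" "\<And>X. card X > k \<Longrightarrow> a X = 0"
    "\<And>T. T \<subseteq> B \<Longrightarrow> card T \<le> k \<Longrightarrow> (\<Sum>X | T \<subseteq> X \<and> X \<subseteq> B. a X) = (if T \<subseteq> F then 1 else 0)"
    using low_degree_interpolation[OF assms(1,2)] by metis
  \<comment> \<open>One factor \<open>2 ^ card B\<close> of the denominator pays for the bound on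
    \<open>a\<close>, the other for
    \<open>(1 - p) ^ card (B - X) \<ge> (1/2) ^ card B\<close>.\<close>
  define c where "c = p ^ k / 4 ^ card B"
  define \<mu> where "\<mu> = (\<lambda>X. p ^ card X * (1 - p) ^ card (B - X))"
  define w where "w = (\<lambda>X. \<mu> X - c * a X + (if X = F then c else 0))"
  have c: "c \<ge> 0" using assms by (simp add: c_def)
  have le: "c * a X \<le> \<mu> X" if X: "X \<subseteq> B" for X
  proof (cases "card X > k")
    case True
    then show ?thesis using a(2) assms by (simp add: \<mu>_def)
  next
    case False
    have "c * a X \<le> c * 2 ^ card B"
      using a(1)[of X] c by (intro mult_left_mono) auto
    also have "\<dots> = p ^ k * (1/2) ^ card B"
      by (simp add: c_def field_simps flip: power_mult_distrib)
    also have "\<dots> \<le> p ^ card X * (1 - p) ^ card (B - X)"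
    proof (rule mult_mono)
      show "p ^ k \<le> p ^ card X" using False assms by (intro power_decreasing) auto
      have "(1/2) ^ card B \<le> (1/2 :: real) ^ card (B - X)"
        using assms by (intro power_decreasing card_mono) auto
      also have "\<dots> \<le> (1 - p) ^ card (B - X)" using assms by (intro power_mono) auto
      finally show "(1/2) ^ card B \<le> (1 - p) ^ card (B - X)" .
    qed (use assms in auto)
    finally show ?thesis by (simp add: \<mu>_def)
  qed
  \<comment> \<open>The point mass adds \<open>c\<close> exactly when
    \<open>T \<subseteq> F\<close>, and the term \<open>- c * a X\<close> takes the same amount
    away. The case \<open>T = {}\<close> then gives total mass 1.\<close>
  have mom: "(\<Sum>X | T \<subseteq> X \<and> X \<subseteq> B. w X) = p ^ card T" if T: "T \<subseteq> B" "card T \<le> k" for T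
  proof -
    have "finite {X. T \<subseteq> X \<and> X \<subseteq> B}" using assms by auto
    then have "(\<Sum>X | T \<subseteq> X \<and> X \<subseteq> B. if X = F then c else 0) = (if T \<subseteq> F then c else 0)"
      using assms by simp
    then show ?thesis
      using a(3)[OF T] sum_bernoulli_weights[OF assms(1) T(1), of p]
      by (simp add: w_def \<mu>_def sum.distrib sum_subtractf flip: sum_distrib_left)
  qed
  have "sum w (Pow B) = 1" using mom[of "{}"] by (simp add: Pow_def)
  moreover have "w X \<ge> 0" if "X \<in> Pow B" for X using le[of X] c that by (auto simp: w_def)
  ultimately obtain D where D: "set_pmf D \<subseteq> Pow B" "\<And>X. X \<in> Pow B \<Longrightarrow> pmf D X = w X"
    using ex_pmf_weights[of "Pow B" w] assms(1) by auto
  show thesis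
  proof (rule that[of D])
    show "set_pmf D \<subseteq> Pow B" by (rule D)
    show "pmf D F \<ge> p ^ k / 4 ^ card B"
      using D(2)[of F] le[of F] assms by (simp add: w_def c_def)
    fix T assume T: "T \<subseteq> B" "card T \<le> k"
    have "measure_pmf.prob D {X. T \<subseteq> X} = measure_pmf.prob D {X. T \<subseteq> X \<and> X \<subseteq> B}"
      using D(1) by (intro measure_pmf.finite_measure_eq_AE) (auto simp: AE_measure_pmf_iff)
    also have "\<dots> = (\<Sum>X | T \<subseteq> X \<and> X \<subseteq> B. pmf D X)"
      using assms by (intro measure_measure_pmf_finite) auto
    also have "\<dots> = p ^ card T"
      using mom[OF T] D(2) by simp
    finally show "measure_pmf.prob D {X. T \<subseteq> X} = p ^ card T" .
  qed
qed

section \<open>Independence from moments, and products over disjoint blocks\<close>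

text \<open>Singletons \<open>T\<close> show that each event \<open>e \<in> Y \<omega>\<close> has
  probability \<open>p\<close>, so the hypothesis is the product rule for these events. A family of
  one event is intersection-stable, hence independence passes to the generated sigma-algebras, which
  contain all preimages under the indicators.\<close>

lemma indep_vars_indicator_pmf:
  fixes M :: "'b pmf" and Y :: "'b \<Rightarrow> 'e set"
  assumes "\<And>T. T \<subseteq> S \<Longrightarrow> finite T \<Longrightarrow> measure_pmf.prob M {\<omega>. T \<subseteq> Y \<omega>} = p ^ card T"
  shows "prob_space.indep_vars (measure_pmf M) (\<lambda>_. borel) (\<lambda>e \<omega>. indicator (Y \<omega>) e :: real) S"
proof -
  let ?A = "\<lambda>e. {\<omega>. e \<in> Y \<omega>}"
  have "prob_space.indep_events (measure_pmf M) ?A S"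
  proof (rule prob_space.indep_eventsI[OF measure_pmf.prob_space_axioms])
    fix T assume T: "T \<subseteq> S" "finite T" "T \<noteq> {}"
    have "measure_pmf.prob M (?A e) = p" if "e \<in> T" for e
      using assms[of "{e}"] that T by auto
    moreover have "(\<Inter>e\<in>T. ?A e) = {\<omega>. T \<subseteq> Y \<omega>}" by auto
    ultimately show "measure_pmf.prob M (\<Inter>e\<in>T. ?A e) = (\<Prod>e\<in>T. measure_pmf.prob M (?A e))"
      using assms[OF T(1,2)] by simp
  qed simp
  then have "prob_space.indep_sets (measure_pmf M) (\<lambda>e. {?A e}) S"
    by (simp add: prob_space.indep_events_def_alt[OF measure_pmf.prob_space_axioms])
  then have sig: "prob_space.indep_sets (measure_pmf M) (\<lambda>e. sigma_sets UNIV {?A e}) S"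
    using prob_space.indep_sets_sigma[OF measure_pmf.prob_space_axioms, of M "\<lambda>e. {?A e}" S] by (simp add: Int_stable_def)
  have "prob_space.indep_sets (measure_pmf M)
      (\<lambda>e. {(\<lambda>\<omega>. indicator (Y \<omega>) e :: real) -` A \<inter> space (measure_pmf M) |A. A \<in> sets borel}) S"
  proof (rule prob_space.indep_sets_mono_sets[OF measure_pmf.prob_space_axioms sig], rule subsetI)
    fix e Z
    assume "Z \<in> {(\<lambda>\<omega>. indicator (Y \<omega>) e :: real) -` A \<inter> space (measure_pmf M) |A. A \<in> sets borel}"
    then obtain A where Z: "Z = (\<lambda>\<omega>. indicator (Y \<omega>) e :: real) -` A" by auto
    have s: "?A e \<in> sigma_sets UNIV {?A e}" by auto
    then have s': "UNIV - ?A e \<in> sigma_sets UNIV {?A e}" by (rule sigma_sets.Compl)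
    \<comment> \<open>The indicator only takes the values 0 and 1, so the preimage of
      \<open>A\<close> depends only on which of them lie in \<open>A\<close>.\<close>
    have "Z \<in> {{}, UNIV, ?A e, UNIV - ?A e}"
      unfolding Z by (cases "0 \<in> A"; cases "1 \<in> A") (auto simp: indicator_def of_bool_def split: if_splits)
    then show "Z \<in> sigma_sets UNIV {?A e}"
      using s s' sigma_sets.Empty sigma_sets_top by blast
  qed
  then show ?thesis unfolding prob_space.indep_vars_def2[OF measure_pmf.prob_space_axioms] by simp
qed

text \<open>Disjointness of the blocks splits the event into independent conditions
  \<open>T \<inter> B i \<subseteq> X i\<close>, and the exponents add up to \<open>card T\<close>.
  The traces \<open>T \<inter> B i\<close> are no larger than \<open>T\<close>, which is why
  \<open>k\<close>-wise independence inside each block yields it for the union.\<close>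

lemma prob_superset_Union_Pi_pmf:
  fixes D :: "'i \<Rightarrow> 'e set pmf"
  assumes "finite I" "disjoint_family_on B I" "\<And>i. i \<in> I \<Longrightarrow> set_pmf (D i) \<subseteq> Pow (B i)"
    and T: "T \<subseteq> (\<Union>i\<in>I. B i)" "finite T"
    and mom: "\<And>i. i \<in> I \<Longrightarrow> measure_pmf.prob (D i) {Y. T \<inter> B i \<subseteq> Y} = p ^ card (T \<inter> B i)"
  shows "measure_pmf.prob (Pi_pmf I {} D) {X. T \<subseteq> (\<Union>i\<in>I. X i)} = p ^ card T"
proof -
  have "X \<in> Pi I (\<lambda>i. {Y. T \<inter> B i \<subseteq> Y}) \<longleftrightarrow> T \<subseteq> (\<Union>i\<in>I. X i)"
    if "X \<in> set_pmf (Pi_pmf I {} D)" for X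
  proof -
    have X: "X i \<subseteq> B i" if "i \<in> I" for i
      using assms(3)[OF that] that \<open>X \<in> _\<close> set_Pi_pmf_subset'[OF assms(1), of "{}" D]
      by (auto simp: PiE_dflt_def)
    show ?thesis
    proof
      assume L: "T \<subseteq> (\<Union>i\<in>I. X i)"
      have "t \<in> X i" if i: "i \<in> I" "t \<in> T" "t \<in> B i" for i t
      proof -
        obtain j where "j \<in> I" "t \<in> X j" using L i by auto
        then have "j = i"
          using X[of j] i assms(2) unfolding disjoint_family_on_def by blast
        then show ?thesis using \<open>t \<in> X j\<close> by simp
      qed
      then show "X \<in> Pi I (\<lambda>i. {Y. T \<inter> B i \<subseteq> Y})" by auto
    next
      assume R: "X \<in> Pi I (\<lambda>i. {Y. T \<inter> B i \<subseteq> Y})"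
      show "T \<subseteq> (\<Union>i\<in>I. X i)"
      proof
        fix t assume "t \<in> T"
        then obtain i where "i \<in> I" "t \<in> B i" using T by auto
        with R \<open>t \<in> T\<close> show "t \<in> (\<Union>i\<in>I. X i)" by (auto simp: Pi_iff)
      qed
    qed
  qed
  then have "measure_pmf.prob (Pi_pmf I {} D) {X. T \<subseteq> (\<Union>i\<in>I. X i)}
      = measure_pmf.prob (Pi_pmf I {} D) (Pi I (\<lambda>i. {Y. T \<inter> B i \<subseteq> Y}))"
    by (intro measure_pmf.finite_measure_eq_AE) (auto simp: AE_measure_pmf_iff)
  also have "\<dots> = (\<Prod>i\<in>I. p ^ card (T \<inter> B i))"
    by (simp add: measure_Pi_pmf_Pi assms(1) mom)
  also have "\<dots> = p ^ card (\<Union>i\<in>I. T \<inter> B i)"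
    using assms(1,2) T(2) by (subst card_UN_disjoint) (auto simp: power_sum disjoint_family_on_def)
  also have "(\<Union>i\<in>I. T \<inter> B i) = T" using T by auto
  finally show ?thesis .
qed

section \<open>Edge-disjoint placements and induced copies\<close>

text \<open>The vertex of \<open>V\<close> with index \<open>x\<close> is sent to the lattice point \<open>(x, a * x + b)\<close>, encoded as a
  number in \<open>{1..N}\<close>. Distinct lines share at most one point, hence no edge.\<close>

lemma edge_disjoint_copies:
  fixes V :: "'a set"
  assumes "finite V" "L * card V ^ 2 \<le> N"
  obtains \<phi> :: "nat \<times> nat \<Rightarrow> 'a \<Rightarrow> nat"
  where "\<And>i. i \<in> {..<L} \<times> {..<L} \<Longrightarrow> inj_on (\<phi> i) V"
    "\<And>i. i \<in> {..<L} \<times> {..<L} \<Longrightarrow> \<phi> i ` V \<subseteq> {1..N}"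
    "disjoint_family_on (\<lambda>i. potential_edges (\<phi> i ` V)) ({..<L} \<times> {..<L})"
proof -
  define h where "h = card V"
  obtain x where "bij_betw x V {0..<h}"
    using ex_bij_betw_finite_nat[OF assms(1)] by (auto simp: h_def)
  then have x: "inj_on x V" "\<And>v. v \<in> V \<Longrightarrow> x v < h"
    by (auto simp: bij_betw_def)
  define y where "y = (\<lambda>i v. fst i * x v + snd i)"
  \<comment> \<open>A two-digit number in base \<open>h * L\<close> with leading digit
    \<open>x v\<close>, shifted by 1 to start the range at 1. With \<open>h\<close> leading digits
    there are \<open>h * (h * L) \<le> N\<close> codes.\<close>
  define \<phi> where "\<phi> = (\<lambda>i v. x v * (h * L) + y i v + 1)"
  have y: "y i v < h * L" if "i \<in> {..<L} \<times> {..<L}" "v \<in> V" for i v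
  proof -
    obtain a b where i: "i = (a, b)" "a < L" "b < L" using \<open>i \<in> _\<close> by auto
    have "a * x v + b < L * x v + L" using i by (simp add: add_le_less_mono)
    also have "\<dots> = L * Suc (x v)" by simp
    also have "\<dots> \<le> L * h" using x(2)[OF \<open>v \<in> V\<close>] by (intro mult_le_mono2) simp
    finally show ?thesis by (simp add: y_def i mult.commute)
  qed
  have eq: "u = v \<and> y i u = y j u"
    if "\<phi> i u = \<phi> j v" "i \<in> {..<L} \<times> {..<L}" "j \<in> {..<L} \<times> {..<L}" "u \<in> V" "v \<in> V" for i j u v
  proof -
    have e: "x u * (h * L) + y i u = x v * (h * L) + y j v" using that by (simp add: \<phi>_def)
    have "y i u < h * L" "y j v < h * L"
      using y that by blast+
    \<comment> \<open>Division by the base recovers the leading digit, so equal codes mean the same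
      vertex and the same height.\<close>
    then have "(x u * (h * L) + y i u) div (h * L) = x u" "(x v * (h * L) + y j v) div (h * L) = x v"
      by (metis add.right_neutral div_less div_mult_self3 less_nat_zero_code)+
    then have "x u = x v" using e by simp
    then show ?thesis using x(1) that e by (auto simp: inj_on_def)
  qed
  show thesis
  proof
    fix i assume i: "i \<in> {..<L} \<times> {..<L}"
    show "inj_on (\<phi> i) V" using eq i by (auto simp: inj_on_def)
    show "\<phi> i ` V \<subseteq> {1..N}"
    proof
      fix n assume "n \<in> \<phi> i ` V"
      then obtain v where v: "v \<in> V" "n = \<phi> i v" by auto
      have "n \<le> x v * (h * L) + h * L" using y[OF i v(1)] v by (simp add: \<phi>_def)
      also have "\<dots> = Suc (x v) * (h * L)" by simp
      also have "\<dots> \<le> h * (h * L)" using x(2)[OF v(1)] by (intro mult_le_mono1) simp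
      also have "\<dots> \<le> N" using assms(2) by (simp add: h_def power2_eq_square mult.commute mult.left_commute)
      finally show "n \<in> {1..N}" using v by (simp add: \<phi>_def)
    qed
  next
    show "disjoint_family_on (\<lambda>i. potential_edges (\<phi> i ` V)) ({..<L} \<times> {..<L})"
    proof (unfold disjoint_family_on_def, intro ballI impI)
      fix i j :: "nat \<times> nat"
      assume ij: "i \<in> {..<L} \<times> {..<L}" "j \<in> {..<L} \<times> {..<L}" "i \<noteq> j"
      have False if e: "e \<in> potential_edges (\<phi> i ` V)" "e \<in> potential_edges (\<phi> j ` V)" for e
      proof -
        obtain m n where mn: "e = {m, n}" "m \<noteq> n"
          using e by (auto simp: potential_edges_def card_2_iff)
        have "m \<in> \<phi> i ` V" "m \<in> \<phi> j ` V" "n \<in> \<phi> i ` V" "n \<in> \<phi> j ` V"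
          using e mn by (auto simp: potential_edges_def)
        then obtain u v u' v' where uv: "m = \<phi> i u" "m = \<phi> j u'" "n = \<phi> i v" "n = \<phi> j v'"
          "u \<in> V" "v \<in> V" "u' \<in> V" "v' \<in> V"
          by (elim imageE) metis
        have yy: "y i u = y j u" "y i v = y j v"
          using eq[of i u j u'] eq[of i v j v'] uv ij by auto
        have "x u \<noteq> x v" using mn uv x(1) by (auto simp: inj_on_def)
        obtain a b a' b' where ab: "i = (a, b)" "j = (a', b')" by fastforce
        \<comment> \<open>Two lines agree at two abscissae. Subtracting the equations, over
          \<open>int\<close> to avoid truncation, forces equal slopes and then equal
          intercepts.\<close>
        have "int a * int (x u) + int b = int a' * int (x u) + int b'"
          "int a * int (x v) + int b = int a' * int (x v) + int b'"
          using yy by (simp_all add: y_def ab flip: of_nat_mult of_nat_add)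
        then have "(int a - int a') * (int (x u) - int (x v)) = 0"
          by (simp add: algebra_simps)
        then have "a = a'" using \<open>x u \<noteq> x v\<close> by simp
        then have "i = j" using yy by (simp add: y_def ab)
        then show False using ij by simp
      qed
      then show "potential_edges (\<phi> i ` V) \<inter> potential_edges (\<phi> j ` V) = {}" by auto
    qed
  qed
qed

text \<open>Condition \<open>E\<close> fixes all pairs inside the image, non-edges included, which
  makes the copy induced; injectivity of \<open>f\<close> allows edges to be pulled back.\<close>

lemma contains_induced_copyI:
  assumes H: "simple_graph H" and G: "simple_graph G"
    and f: "inj_on f (verts H)" "f ` verts H \<subseteq> verts G"
    and E: "edges G \<inter> potential_edges (f ` verts H) = (`) f ` edges H"
  shows "contains_induced_copy G H"
proof -
  have HV: "e \<subseteq> verts H \<and> card e = 2" if "e \<in> edges H" for e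
    using H that by (auto simp: simple_graph_def potential_edges_def)
  have GV: "card e = 2" if "e \<in> edges G" for e
    using G that by (auto simp: simple_graph_def potential_edges_def)
  have "{u, v} \<in> edges H \<longleftrightarrow> {f u, f v} \<in> edges G" if uv: "u \<in> verts H" "v \<in> verts H" for u v
  proof
    assume "{u, v} \<in> edges H"
    then have "f ` {u, v} \<in> (`) f ` edges H" by (rule imageI)
    then show "{f u, f v} \<in> edges G" using E by auto
  next
    assume e: "{f u, f v} \<in> edges G"
    \<comment> \<open>Edges of \<open>G\<close> have two elements, so \<open>u = v\<close> cannot
      occur here.\<close>
    then have "{f u, f v} \<in> potential_edges (f ` verts H)"
      using GV uv by (auto simp: potential_edges_def)
    then have "f ` {u, v} \<in> (`) f ` edges H" using e E by auto
    then obtain e' where e': "e' \<in> edges H" "f ` {u, v} = f ` e'" by auto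
    then have "{u, v} = e'"
      using HV[OF e'(1)] uv f(1) inj_on_image_eq_iff[of f "verts H" "{u, v}" e'] by auto
    then show "{u, v} \<in> edges H" using e' by simp
  qed
  then have "isomorphic H (induced_subgraph G (f ` verts H))"
    using f(1) unfolding isomorphic_def induced_subgraph_def
    by (intro exI[of _ f]) (auto simp: bij_betw_def)
  then show ?thesis unfolding contains_induced_copy_def using f(2) by blast
qed

lemma finite_potential_edges: "finite V \<Longrightarrow> finite (potential_edges V)"
  unfolding potential_edges_def by (rule finite_subset[of _ "Pow V"]) auto

lemma card_potential_edges_le: "finite V \<Longrightarrow> card (potential_edges V) \<le> 2 ^ card V"
  using card_mono[of "Pow V" "potential_edges V"] by (auto simp: potential_edges_def card_Pow)

section \<open>The random graph for a fixed number of vertices\<close>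

text \<open>The potential edges are split into \<open>L\<^sup>2\<close> copies and a remainder,
  drawn independently, each from a \<open>k\<close>-wise independent law. Every copy equals
  \<open>H\<close> with probability at least \<open>p ^ k / 4 ^ (2 ^ card (verts H))\<close>, so the
  failure probabilities multiply.\<close>

lemma kwise_graph_containing_copy:
  fixes H :: "'a ugraph" and p :: real
  assumes H: "simple_graph H" and p: "0 < p" "p \<le> 1/2" and LN: "L * card (verts H) ^ 2 \<le> N"
  obtains G where "\<And>g. g \<in> set_pmf G \<Longrightarrow> simple_graph g \<and> verts g = {1..N}"
    "\<And>T. T \<subseteq> potential_edges {1..N} \<Longrightarrow> card T \<le> k \<Longrightarrow>
      measure_pmf.prob G {g. T \<subseteq> edges g} = p ^ card T"
    "measure_pmf.prob G {g. \<not> contains_induced_copy g H}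
      \<le> (1 - p ^ k / 4 ^ (2 ^ card (verts H))) ^ L\<^sup>2"
proof -
  define V where "V = verts H"
  define I where "I = {..<L} \<times> {..<L}"
  have V: "finite V" using H by (simp add: simple_graph_def V_def)
  obtain \<phi> where \<phi>: "\<And>i. i \<in> I \<Longrightarrow> inj_on (\<phi> i) V" "\<And>i. i \<in> I \<Longrightarrow> \<phi> i ` V \<subseteq> {1..N}"
    "disjoint_family_on (\<lambda>i. potential_edges (\<phi> i ` V)) I"
    using edge_disjoint_copies[OF V, of L N] LN unfolding V_def I_def by blast
  \<comment> \<open>\<open>Some i\<close> indexes the \<open>i\<close>-th copy and
    \<open>None\<close> the leftover potential edges. The target set \<open>{}\<close> at
    \<open>None\<close> is a default that lets the same block construction serve there.\<close>
  define J where "J = insert None (Some ` I)"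
  define B where "B = (\<lambda>j. case j of
      Some i \<Rightarrow> potential_edges (\<phi> i ` V)
    | None \<Rightarrow> potential_edges {1..N} - (\<Union>i\<in>I. potential_edges (\<phi> i ` V)))"
  define F where "F = (\<lambda>j. case j of Some i \<Rightarrow> (`) (\<phi> i) ` edges H | None \<Rightarrow> {})"
  have finI: "finite I" by (simp add: I_def)
  have finJ: "finite J" by (simp add: J_def finI)
  have BN: "(\<Union>j\<in>J. B j) = potential_edges {1..N}"
  proof -
    have "potential_edges (\<phi> i ` V) \<subseteq> potential_edges {1..N}" if "i \<in> I" for i
      using \<phi>(2)[OF that] by (auto simp: potential_edges_def)
    then show ?thesis by (auto simp: J_def B_def)
  qed
  have finB: "finite (B j)" if "j \<in> J" for j
    using BN that finite_potential_edges[of "{1..N}"] by (metis UN_upper finite_atLeastAtMost finite_subset)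
  have disj: "disjoint_family_on B J"
    using \<phi>(3) unfolding disjoint_family_on_def J_def B_def by auto
  have F: "F j \<subseteq> B j" if "j \<in> J" for j
  proof (cases j)
    case (Some i)
    then have "i \<in> I" using that by (auto simp: J_def)
    have "\<phi> i ` e \<in> potential_edges (\<phi> i ` V)" if "e \<in> edges H" for e
    proof -
      have "e \<subseteq> V" "card e = 2" using H that by (auto simp: simple_graph_def potential_edges_def V_def)
      moreover have "inj_on (\<phi> i) e" using \<phi>(1)[OF \<open>i \<in> I\<close>] \<open>e \<subseteq> V\<close> by (rule inj_on_subset)
      ultimately show ?thesis by (auto simp: potential_edges_def card_image)
    qed
    then show ?thesis by (auto simp: F_def B_def Some)
  qed (simp add: F_def)
  have "\<exists>D. set_pmf D \<subseteq> Pow (B j) \<and>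
      (\<forall>T. T \<subseteq> B j \<longrightarrow> card T \<le> k \<longrightarrow> measure_pmf.prob D {X. T \<subseteq> X} = p ^ card T) \<and>
      pmf D (F j) \<ge> p ^ k / 4 ^ card (B j)" if "j \<in> J" for j
    using kwise_pmf_heavy_at[OF finB[OF that] F[OF that] p, of k] by metis
  then obtain D where D: "\<And>j. j \<in> J \<Longrightarrow> set_pmf (D j) \<subseteq> Pow (B j)"
    "\<And>j T. j \<in> J \<Longrightarrow> T \<subseteq> B j \<Longrightarrow> card T \<le> k \<Longrightarrow> measure_pmf.prob (D j) {X. T \<subseteq> X} = p ^ card T"
    "\<And>j. j \<in> J \<Longrightarrow> pmf (D j) (F j) \<ge> p ^ k / 4 ^ card (B j)"
    by metis
  define P where "P = Pi_pmf J {} D"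
  define gr where "gr = (\<lambda>X :: (nat \<times> nat) option \<Rightarrow> nat set set. ({1..N}, \<Union>j\<in>J. X j))"
  define G where "G = map_pmf gr P"
  have XB: "X j \<subseteq> B j" if "X \<in> set_pmf P" "j \<in> J" for X j
    using D(1)[OF that(2)] that set_Pi_pmf_subset'[OF finJ, of "{}" D]
    by (auto simp: PiE_dflt_def P_def)
  have simple: "simple_graph (gr X)" if "X \<in> set_pmf P" for X
    using XB[OF that] BN by (fastforce simp: simple_graph_def gr_def)
  show thesis
  proof
    show "simple_graph g \<and> verts g = {1..N}" if "g \<in> set_pmf G" for g
      using that simple by (auto simp: G_def gr_def)
    fix T assume T: "T \<subseteq> potential_edges {1..N}" "card T \<le> k"
    have finT: "finite T" using T finite_potential_edges[of "{1..N}"] finite_subset by auto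
    have "measure_pmf.prob P {X. T \<subseteq> (\<Union>j\<in>J. X j)} = p ^ card T"
      unfolding P_def
    proof (rule prob_superset_Union_Pi_pmf[OF finJ disj D(1)])
      show "T \<subseteq> (\<Union>j\<in>J. B j)" using T BN by simp
      fix j assume "j \<in> J"
      moreover have "card (T \<inter> B j) \<le> k"
        using card_mono[OF finT, of "T \<inter> B j"] T by auto
      ultimately show "measure_pmf.prob (D j) {Y. T \<inter> B j \<subseteq> Y} = p ^ card (T \<inter> B j)"
        using D(2) by auto
    qed (use finT in auto)
    then show "measure_pmf.prob G {g. T \<subseteq> edges g} = p ^ card T"
      by (simp add: G_def gr_def vimage_def)
  next
    \<comment> \<open>The event that every copy misses its target; \<open>UNIV\<close> leaves the
      leftover block free and contributes a factor 1.\<close>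
    define Q where "Q = (\<lambda>j. case j of Some i \<Rightarrow> - {F (Some i)} | None \<Rightarrow> UNIV)"
    have copy: "contains_induced_copy (gr X) H"
      if X: "X \<in> set_pmf P" and i: "i \<in> I" and XF: "X (Some i) = F (Some i)" for X i
    proof (rule contains_induced_copyI[OF H simple[OF X], of "\<phi> i"])
      \<comment> \<open>No other block meets the pairs of copy \<open>i\<close>, so the graph
        restricted to this copy is exactly what its own block drew.\<close>
      have "(\<Union>j\<in>J. X j) \<inter> B (Some i) = X (Some i)"
      proof
        show "(\<Union>j\<in>J. X j) \<inter> B (Some i) \<subseteq> X (Some i)"
        proof
          fix e assume e: "e \<in> (\<Union>j\<in>J. X j) \<inter> B (Some i)"
          then obtain j where j: "j \<in> J" "e \<in> X j" by auto
          then have "e \<in> B j \<inter> B (Some i)" using XB[OF X] e by auto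
          moreover have "Some i \<in> J" using i by (auto simp: J_def)
          ultimately have "j = Some i" using disj j(1) unfolding disjoint_family_on_def by blast
          then show "e \<in> X (Some i)" using j by simp
        qed
        show "X (Some i) \<subseteq> (\<Union>j\<in>J. X j) \<inter> B (Some i)"
          using XB[OF X, of "Some i"] i by (auto simp: J_def)
      qed
      then show "edges (gr X) \<inter> potential_edges (\<phi> i ` verts H) = (`) (\<phi> i) ` edges H"
        using XF by (simp add: gr_def B_def F_def V_def)
    qed (use \<phi>(1,2)[OF i] in \<open>auto simp: V_def gr_def\<close>)
    have "measure_pmf.prob G {g. \<not> contains_induced_copy g H}
        = measure_pmf.prob P {X. \<not> contains_induced_copy (gr X) H}"
      by (simp add: G_def vimage_def)
    also have "\<dots> \<le> measure_pmf.prob P (Pi J Q)"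
      using copy by (intro measure_pmf.finite_measure_mono_AE)
        (auto simp: AE_measure_pmf_iff Q_def J_def split: option.split)
    also have "\<dots> = (\<Prod>j\<in>J. measure_pmf.prob (D j) (Q j))"
      unfolding P_def by (rule measure_Pi_pmf_Pi[OF finJ])
    also have "\<dots> = (\<Prod>i\<in>I. measure_pmf.prob (D (Some i)) (Q (Some i)))"
      unfolding J_def using finI by (subst prod.insert) (auto simp: prod.reindex Q_def)
    also have "\<dots> = (\<Prod>i\<in>I. 1 - pmf (D (Some i)) (F (Some i)))"
      by (simp add: Q_def measure_pmf.prob_compl[of "{_}", simplified] pmf.rep_eq Compl_eq_Diff_UNIV)
    \<comment> \<open>Bounding the number of pairs in a copy by \<open>2 ^ card V\<close> makes the
      loss a constant depending only on the number of vertices of \<open>H\<close>.\<close>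
    also have "\<dots> \<le> (\<Prod>i\<in>I. 1 - p ^ k / 4 ^ (2 ^ card V))"
    proof (rule prod_mono)
      fix i assume i: "i \<in> I"
      then have iJ: "Some i \<in> J" by (simp add: J_def)
      have "card (B (Some i)) \<le> 2 ^ card V"
        using card_potential_edges_le[of "\<phi> i ` V"] V card_image[OF \<phi>(1)[OF i]] by (simp add: B_def)
      then have "p ^ k / 4 ^ (2 ^ card V) \<le> p ^ k / 4 ^ card (B (Some i))"
        using p by (intro divide_left_mono power_increasing) auto
      then show "0 \<le> 1 - pmf (D (Some i)) (F (Some i)) \<and>
          1 - pmf (D (Some i)) (F (Some i)) \<le> 1 - p ^ k / 4 ^ (2 ^ card V)"
        using D(3)[OF iJ] pmf_le_1[of "D (Some i)"] by simp
    qed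
    also have "\<dots> = (1 - p ^ k / 4 ^ (2 ^ card (verts H))) ^ L\<^sup>2"
      by (simp add: I_def V_def power2_eq_square)
    finally show "measure_pmf.prob G {g. \<not> contains_induced_copy g H}
      \<le> (1 - p ^ k / 4 ^ (2 ^ card (verts H))) ^ L\<^sup>2" .
  qed
qed

section \<open>Choice of parameters and asymptotics\<close>

text \<open>A finite graph has finitely many subgraphs, \<open>H\<close> itself qualifies, and an
  edge forces a vertex: the minimum is over a finite non-empty set of positive ratios.\<close>

lemma rho_pos:
  assumes "simple_graph H" "edges H \<noteq> {}"
  shows "rho H > 0"
proof -
  let ?R = "{real (card (verts H')) / real (card (edges H')) | H'. subgraph H' H \<and> edges H' \<noteq> {}}"
  have fin: "finite (verts H)" "finite (edges H)"
    using assms finite_potential_edges finite_subset by (auto simp: simple_graph_def)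
  have "{H'. subgraph H' H \<and> edges H' \<noteq> {}} \<subseteq> Pow (verts H) \<times> Pow (edges H)"
    by (auto simp: subgraph_def)
  then have "finite {H'. subgraph H' H \<and> edges H' \<noteq> {}}"
    using fin by (meson finite_Pow_iff finite_SigmaI finite_subset)
  then have "finite ?R" by (rule finite_image_set)
  moreover have "subgraph H H" using assms by (simp add: subgraph_def)
  then have "?R \<noteq> {}" using assms by blast
  moreover have "r > 0" if r: "r \<in> ?R" for r
  proof -
    obtain H' where H': "r = real (card (verts H')) / real (card (edges H'))"
      "subgraph H' H" "edges H' \<noteq> {}" using r by blast
    then have "finite (verts H')" "finite (edges H')" "verts H' \<noteq> {}"
      using fin finite_subset by (auto simp: subgraph_def simple_graph_def potential_edges_def)
    then show ?thesis using H' by (simp add: card_gt_0_iff)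
  qed
  ultimately show ?thesis unfolding rho_def by (subst Min_gr_iff) auto
qed

lemma power_one_minus_le_exp:
  fixes x :: real
  assumes "x \<le> 1"
  shows "(1 - x) ^ n \<le> exp (- (x * real n))"
proof -
  have "(1 - x) ^ n \<le> exp (- x) ^ n"
    using assms exp_ge_add_one_self[of "- x"] by (intro power_mono) auto
  also have "\<dots> = exp (- (x * real n))" by (simp add: mult.commute flip: exp_of_nat_mult)
  finally show ?thesis .
qed

theorem mainTheorem7:
  fixes H :: "'a ugraph"
  assumes "simple_graph H"
    and "edges H \<noteq> {}"
    and "rho H < 2"
  shows "\<exists>(p :: nat \<Rightarrow> real) (\<G> :: nat \<Rightarrow> nat ugraph pmf).
           (\<forall>N. 0 < p N \<and> p N < 1) \<and>
           (\<lambda>N. p N / p_star H N) \<longlonglongrightarrow> 0 \<and>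
           kwise_indep_random_graph (\<lambda>N. nat \<lceil>2 / rho H - 1\<rceil>) p \<G> \<and>
           (\<lambda>N. measure_pmf.prob (\<G> N) {G. contains_induced_copy G H}) \<longlonglongrightarrow> 1"
proof -
  define k where "k = nat \<lceil>2 / rho H - 1\<rceil>"
  have rho: "rho H > 0" using rho_pos assms by blast
  have "2 / rho H > 1" using rho assms by simp
  \<comment> \<open>A ceiling exceeds its argument by less than 1, so \<open>k\<close> is strictly
    below \<open>2 / rho H\<close>; this strictness leaves room for \<open>c\<close>.\<close>
  then have "k \<ge> 1" and "real k < 2 / rho H" unfolding k_def by linarith+
  then have "rho H < 2 / real k" using rho by (simp add: field_simps)
  \<comment> \<open>The lower bound on \<open>c\<close> makes \<open>p\<close> negligible against
    \<open>p_star H\<close>; the upper bound makes \<open>N^2 * p N ^ k\<close> grow.\<close>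
  then obtain c where c: "rho H < c" "c < 2 / real k" using dense by blast
  then have ck: "2 - c * real k > 0" using \<open>k \<ge> 1\<close> by (simp add: field_simps)
  \<comment> \<open>\<open>max 1 N\<close> keeps \<open>p\<close> positive at \<open>N = 0\<close>;
    the factor \<open>1/2\<close> provides the bound \<open>p \<le> 1/2\<close> needed in the block
    construction.\<close>
  define p where "p = (\<lambda>N :: nat. real (max 1 N) powr (- c) / 2)"
  have p: "0 < p N" "p N \<le> 1/2" for N
    using c rho powr_mono[of "- c" 0 "real (max 1 N)"] by (auto simp: p_def)
  define h where "h = card (verts H)"
  define d where "d = h\<^sup>2"
  have "verts H \<noteq> {}" "finite (verts H)"
    using assms by (auto simp: simple_graph_def potential_edges_def)
  then have "d > 0" by (simp add: d_def h_def card_gt_0_iff)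
  define b where "b = (2 :: nat) ^ h"
  define q where "q = (\<lambda>N. p N ^ k / 4 ^ b)"
  define L where "L = (\<lambda>N. N div d)"
  define good where "good = (\<lambda>N G. (\<forall>g\<in>set_pmf G. simple_graph g \<and> verts g = {1..N}) \<and>
      (\<forall>T. T \<subseteq> potential_edges {1..N} \<longrightarrow> card T \<le> k \<longrightarrow>
        measure_pmf.prob G {g. T \<subseteq> edges g} = p N ^ card T) \<and>
      measure_pmf.prob G {g. \<not> contains_induced_copy g H} \<le> (1 - q N) ^ (L N)\<^sup>2)"
  have "\<exists>G. good N G" for N
  proof -
    have LN: "L N * card (verts H) ^ 2 \<le> N" by (simp add: L_def d_def h_def)
    show ?thesis
      by (rule kwise_graph_containing_copy[OF assms(1) p(1)[of N] p(2)[of N] LN, of k],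
          rule exI, unfold good_def q_def b_def h_def) blast
  qed
  then obtain \<G> where "\<And>N. good N (\<G> N)" by metis
  then have \<G>: "\<And>N g. g \<in> set_pmf (\<G> N) \<Longrightarrow> simple_graph g \<and> verts g = {1..N}"
    "\<And>N T. T \<subseteq> potential_edges {1..N} \<Longrightarrow> card T \<le> k \<Longrightarrow>
        measure_pmf.prob (\<G> N) {g. T \<subseteq> edges g} = p N ^ card T"
    "\<And>N. measure_pmf.prob (\<G> N) {g. \<not> contains_induced_copy g H} \<le> (1 - q N) ^ (L N)\<^sup>2"
    unfolding good_def by blast+
  have "kwise_indep_random_graph (\<lambda>N. k) p \<G>"
    unfolding kwise_indep_random_graph_def
  proof (intro allI conjI ballI impI)
    fix N :: nat and S assume S: "S \<subseteq> potential_edges {1..N}" "card S \<le> k"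
    have "finite S" by (rule finite_subset[OF S(1) finite_potential_edges]) simp
    show "prob_space.indep_vars (measure_pmf (\<G> N)) (\<lambda>_. borel)
        (\<lambda>e G. indicator (edges G) e :: real) S"
    proof (rule indep_vars_indicator_pmf)
      fix T assume T: "T \<subseteq> S"
      show "measure_pmf.prob (\<G> N) {g. T \<subseteq> edges g} = p N ^ card T"
        using S T card_mono[OF \<open>finite S\<close> T] by (intro \<G>(2)) auto
    qed
  next
    fix N :: nat and e assume "e \<in> potential_edges {1..N}"
    \<comment> \<open>A single edge is a moment of order 1, available because
      \<open>k \<ge> 1\<close>.\<close>
    then show "measure_pmf.prob (\<G> N) {G. e \<in> edges G} = p N"
      using \<G>(2)[of "{e}" N] \<open>k \<ge> 1\<close> by simp
  next
    fix N g assume "g \<in> set_pmf (\<G> N)"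
    from \<G>(1)[OF this] show "simple_graph g" "verts g = {1..N}" by simp_all
  qed
  moreover have "(\<lambda>N. p N / p_star H N) \<longlonglongrightarrow> 0"
  proof -
    have "(\<lambda>N. real N powr (rho H - c) / 2) \<longlonglongrightarrow> 0"
      using c tendsto_neg_powr[of "rho H - c" "\<lambda>N. real N" sequentially]
      by (intro tendsto_divide_zero) (auto intro: filterlim_real_sequentially)
    moreover have "\<forall>\<^sub>F N in sequentially. real N powr (rho H - c) / 2 = p N / p_star H N"
      using eventually_ge_at_top[of 1]
    proof eventually_elim
      case (elim N)
      then have "max 1 N = N" by simp
      then show ?case
        by (simp add: p_def p_star_def powr_diff powr_minus divide_simps)
    qed
    ultimately show ?thesis by (rule Lim_transform_eventually)
  qed
  moreover have "(\<lambda>N. measure_pmf.prob (\<G> N) {G. contains_induced_copy G H}) \<longlonglongrightarrow> 1"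
  proof -
    \<comment> \<open>The constants collected: \<open>2 ^ k\<close> from the halving in
      \<open>p\<close>, \<open>4 ^ b\<close> from \<open>q\<close>, and
      \<open>(2 * real d)\<^sup>2\<close> from \<open>L N \<ge> N / (2 * d)\<close>.\<close>
    define C where "C = 1 / (2 ^ k * 4 ^ b * (2 * real d)\<^sup>2)"
    have "C > 0" using \<open>d > 0\<close> by (simp add: C_def)
    have "filterlim (\<lambda>N. C * real N powr (2 - c * real k)) at_top sequentially"
      using \<open>C > 0\<close> ck by (intro filterlim_tendsto_pos_mult_at_top[OF tendsto_const]
          filterlim_compose[OF real_powr_at_top filterlim_real_sequentially])
    moreover have "\<forall>\<^sub>F N in sequentially. C * real N powr (2 - c * real k) \<le> q N * real ((L N)\<^sup>2)"
      using eventually_ge_at_top[of d]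
    proof eventually_elim
      case (elim N)
      then have "N \<ge> 1" "L N \<ge> 1" using \<open>d > 0\<close> by (simp_all add: L_def div_greater_zero_iff Suc_leI)
      \<comment> \<open>Rounding down in \<open>N div d\<close> loses at most a factor 2 once
        \<open>L N \<ge> 1\<close>.\<close>
      have "N < d * (L N + 1)"
        using \<open>d > 0\<close> by (simp add: L_def dividend_less_times_div)
      also have "\<dots> \<le> d * (2 * L N)" using \<open>L N \<ge> 1\<close> by (intro mult_le_mono2) simp
      finally have "real N \<le> real (2 * d * L N)" unfolding of_nat_le_iff by simp
      then have "real N / (2 * real d) \<le> real (L N)" using \<open>d > 0\<close> by (simp add: field_simps)
      then have "(real N / (2 * real d))\<^sup>2 \<le> (real (L N))\<^sup>2" by (intro power_mono) auto
      moreover have "q N = real N powr (- (c * real k)) / (2 ^ k * 4 ^ b)"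
        using \<open>N \<ge> 1\<close> by (simp add: q_def p_def power_divide powr_power mult.commute)
      moreover have "real N powr (2 - c * real k) = (real N)\<^sup>2 * real N powr (- (c * real k))"
        using \<open>N \<ge> 1\<close> powr_add[of "real N" 2 "- (c * real k)"] by simp
      ultimately have "C * real N powr (2 - c * real k) = q N * (real N / (2 * real d))\<^sup>2"
        by (simp add: C_def power_divide)
      also have "\<dots> \<le> q N * (real (L N))\<^sup>2"
        using p(1)[of N] \<open>(real N / _)\<^sup>2 \<le> _\<close> by (intro mult_left_mono) (auto simp: q_def)
      finally show ?case by simp
    qed
    ultimately have "filterlim (\<lambda>N. q N * real ((L N)\<^sup>2)) at_top sequentially"
      by (rule filterlim_at_top_mono)
    then have lim0: "(\<lambda>N. exp (- (q N * real ((L N)\<^sup>2)))) \<longlonglongrightarrow> 0"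
      by (intro filterlim_compose[OF exp_at_bot] filterlim_uminus_at_top[THEN iffD1])
    \<comment> \<open>This keeps the base \<open>1 - q N\<close> nonnegative, as the exponential
      bound requires.\<close>
    have "q N \<le> 1" for N
    proof -
      have "p N ^ k \<le> 1" using p[of N] by (intro power_le_one) auto
      also have "1 \<le> (4::real) ^ b" by simp
      finally show ?thesis by (simp add: q_def)
    qed
    then have "measure_pmf.prob (\<G> N) {g. \<not> contains_induced_copy g H}
        \<le> exp (- (q N * real ((L N)\<^sup>2)))" for N
      by (rule order_trans[OF \<G>(3) power_one_minus_le_exp])
    then have "(\<lambda>N. measure_pmf.prob (\<G> N) {g. \<not> contains_induced_copy g H}) \<longlonglongrightarrow> 0"
      by (intro tendsto_sandwich[OF _ _ tendsto_const lim0] always_eventually) auto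
    then have "(\<lambda>N. 1 - measure_pmf.prob (\<G> N) {g. \<not> contains_induced_copy g H}) \<longlonglongrightarrow> 1 - 0"
      by (intro tendsto_diff tendsto_const)
    moreover have "measure_pmf.prob (\<G> N) {g. contains_induced_copy g H}
        = 1 - measure_pmf.prob (\<G> N) {g. \<not> contains_induced_copy g H}" for N
      using measure_pmf.prob_compl[of "{g. contains_induced_copy g H}" "\<G> N"]
      by (simp add: Collect_neg_eq Compl_eq_Diff_UNIV)
    ultimately show ?thesis by simp
  qed
  moreover have "0 < p N \<and> p N < 1" for N using p[of N] by auto
  ultimately show ?thesis unfolding k_def by blast
qed

end
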